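(* In the system NSA, the principle $\mathbb{LPO}$ is equivalent to the principle $\mathbb{LPR}$. Here $\mathbb{LPO}$ is: for every $\Sigma_1$-formula $P$, $P\oplus{\sim}P$; and $\mathbb{LPR}$ is: $(\forall x\in\mathbb{R})\big(x>0\ \oplus\ {\sim}(x>0)\big)$.
   Context: Notation: $\mathbb{N}$ standard (finite) numbers, ${}^{*}\mathbb{N}$ nonstandard numbers, $\Omega={}^{*}\mathbb{N}\setminus\mathbb{N}$ infinite numbers; ${}^{*}\varphi$ is the star image of $\varphi$ (often suppressed). A formula is $\Delta_0$ if all quantifiers are bounded by terms and no infinite numbers occur; $\Delta_0$-formulas may contain standard numbers and standard sets as parameters. $\Sigma_1$: $(\exists n\in\mathbb{N})\varphi(n)$ with $\varphi$ $\Delta_0$; $\Pi_1$: $(\forall n\in\mathbb{N})\varphi(n)$. Real numbers: a real is a sequence of rationals $x=(q_n)$ with $(\forall k,i\in\mathbb{N})(|q_k-q_{k+i}|<2^{-k})$; $x\in\mathbb{R}$ denotes this (a $\Pi_1$ condition). $x>0$ is the $\Sigma_1$-formula $(\exists n\in\mathbb{N})(q_n>2^{-n})$. The system s-NSA is multi-sorted (standard numbers in $\mathbb{N}$, nonstandard numbers in ${}^{*}\mathbb{N}$, standard sets $\subseteq\mathbb{N}$, nonstandard sets $\subseteq{}^{*}\mathbb{N}$) with axioms: $I\Sigma_1$ and ${}^{*}I\Sigma_1$; ${}^{*}\mathbb{N}$ is an end extension of $\mathbb{N}$; the standard structure embeds into the nonstandard one via an injective homomorphism; $\Omega$-CA: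 for $\Delta_0$ $\psi(n,m)$ and $\omega\in\Omega$, if $(\forall n\in\mathbb{N})(\forall\omega'\in\Omega)[{}^{*}\psi(n,\omega)\leftrightarrow{}^{*}\psi(n,\omega')]$ then $(\exists X\subset\mathbb{N})(\forall n\in\mathbb{N})[{}^{*}\psi(n,\omega)\leftrightarrow n\in X]$; $\Delta_0$-TRANS: $(\forall n\in\mathbb{N})(\forall X\subset\mathbb{N})[\varphi(n,X)\leftrightarrow{}^{*}\varphi(n,X)]$ for $\Delta_0$ $\varphi$; $\Delta_0$-underspill: $(\forall n\in\mathbb{N})(\forall X\subset{}^{*}\mathbb{N})[(\forall\omega\in\Omega){}^{*}\varphi(n,X,\omega)\rightarrow(\exists m\in\mathbb{N})\varphi(n,X,m)]$ for $\Delta_0$ $\varphi$; and the transfer rule (if the system proves $(\forall n\in\mathbb{N})\varphi(n)$ for $\Delta_0$ $\varphi$, it proves $(\forall n\in{}^{*}\mathbb{N}){}^{*}\varphi(n)$). NSA is s-NSA extended with an intermediate level $\mathbb{N}_1$ with $\mathbb{N}\subsetneq\mathbb{N}_1\subsetneq{}^{*}\mathbb{N}$, connected to the other levels by $\Delta_0$-transfer and $\Delta_0$-underspill in the same way as $\mathbb{N}$ and ${}^{*}\mathbb{N}$ are. Elements of $\mathbb{N}_1$ are called 1-finite. $\Omega$-invariance: for $\Delta_0$ $\psi(\vec x,m)$ and fixed $\omega\in\Omega$, $\psi(\vec x,\omega)$ is $\Omega$-invariant if $(\forall\vec x\in\mathbb{N}^k)(\forall\omega'\in\Omega)(\psi(\vec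 x,\omega)\leftrightarrow\psi(\vec x,\omega'))$. The predicate "$A\in\mathbb{T}$" (for $\varphi$ $\Delta_0$): $(\forall n\in\mathbb{N})\varphi(n)\in\mathbb{T}$ is $(\forall n\in\mathbb{N})\varphi(n)\rightarrow(\forall n\in{}^{*}\mathbb{N})\varphi(n)$; $(\exists n\in{}^{*}\mathbb{N})\varphi(n)\in\mathbb{T}$ is $(\exists n\in{}^{*}\mathbb{N})\varphi(n)\rightarrow(\exists n\in\mathbb{N}_1)\varphi(n)$; $(\forall n\in\mathbb{N})(\exists m\in\mathbb{N})\varphi(n,m)\in\mathbb{T}$ is $(\forall n\in\mathbb{N})(\exists m\in\mathbb{N})\varphi(n,m)\rightarrow(\forall n\in{}^{*}\mathbb{N})(\exists m\in{}^{*}\mathbb{N})[m \text{ is } n\text{-finite}\wedge\varphi(n,m)]$; $(\exists n\in{}^{*}\mathbb{N})(\forall m\in{}^{*}\mathbb{N})\varphi(n,m)\in\mathbb{T}$ is $(\exists n\in{}^{*}\mathbb{N})(\forall m\in{}^{*}\mathbb{N})\varphi(n,m)\rightarrow(\exists n\in\mathbb{N}_1)(\forall m\in{}^{*}\mathbb{N})\varphi(n,m)$; for formulas not suitable for transfer, such as $(\exists n\in\mathbb{N})\varphi(n)$, $(\exists n\in\mathbb{N}_1)\varphi(n)$, $0=1$ and $(\forall n\in{}^{*}\mathbb{N})\varphi(n)$, "$A\in\mathbb{T}$" is the trivial formula $0=0$. Hyperconnectives: $A\Rrightarrow B$ is $[A\wedge A\in\mathbb{T}]\rightarrow[B\wedge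 B\in\mathbb{T}]$; ${\sim}A$ is $A\Rrightarrow 0=1$; for $A,B$ with standard parameters $\vec x$, $A\oplus B$ means: there is an $\Omega$-invariant formula $\psi(\vec x,\omega)$ such that for all standard parameters $\vec x$, $\psi(\vec x,\omega)\rightarrow[A(\vec x)\wedge A(\vec x)\in\mathbb{T}]$ and $\neg\psi(\vec x,\omega)\rightarrow[B(\vec x)\wedge B(\vec x)\in\mathbb{T}]$.
   Formalization: In LPR, real numbers are sequences of rationals whose graph is Δ₀-definable with standard number and set parameters, with the star image taken of the defining formula; with only set-coded sequences, LPR → LPO fails in some models of the listed axioms. *)

theory Defs
  imports Main
begin

text \<open>
  The language is that of ordered semirings with a symbol for \<open>x \<mapsto> 2\<^sup>x\<close> (total in
  \<open>I\<Sigma>\<^sub>1\<close>; it lets \<open>q > 2\<^sup>-\<^sup>n\<close> be written as a \<open>\<Delta>\<^sub>0\<close>-formula) and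
  membership in set variables.  Number variables and set variables are named by natural numbers.
  Standard numbers and sets occurring as parameters are values of free variables.  In
  \<open>BEx v t \<phi>\<close>, read \<open>(\<exists>v < t) \<phi>\<close>, the bound \<open>t\<close> is outside the scope of \<open>v\<close>.
\<close>

datatype trm = Var nat | Zero | One | Add trm trm | Mul trm trm | Exp2 trm

datatype delta0 =
    Eq trm trm
  | Less trm trm
  | Mem trm nat
  | Neg delta0
  | Conj delta0 delta0
  | BEx nat trm delta0

text \<open>
  A structure has the universe of its type as \<open>*\<nat>\<close>, and \<open>\<nat> \<subset> \<nat>\<^sub>1\<close> as
  subsets; the embeddings between the number sorts are inclusions.  The set sorts of the three
  levels are families of subsets (Henkin semantics), with embeddings \<open>up0\<close> from the standard
  sets to the sets of level 1 and \<open>up1\<close> from there to the nonstandard sets.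
\<close>

record 'n nsa_struct =
  zer :: 'n
  one :: 'n
  add :: "'n \<Rightarrow> 'n \<Rightarrow> 'n"
  mul :: "'n \<Rightarrow> 'n \<Rightarrow> 'n"
  exp2 :: "'n \<Rightarrow> 'n"
  lss :: "'n \<Rightarrow> 'n \<Rightarrow> bool"
  stdN :: "'n set"
  midN :: "'n set"
  stdP :: "'n set set"
  midP :: "'n set set"
  extP :: "'n set set"
  up0 :: "'n set \<Rightarrow> 'n set"
  up1 :: "'n set \<Rightarrow> 'n set"

definition star :: "'n nsa_struct \<Rightarrow> 'n set \<Rightarrow> 'n set" where
  "star M X = up1 M (up0 M X)"

definition Omega :: "'n nsa_struct \<Rightarrow> 'n set" where
  "Omega M = - stdN M"

fun tval :: "'n nsa_struct \<Rightarrow> (nat \<Rightarrow> 'n) \<Rightarrow> trm \<Rightarrow> 'n" where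
  "tval M e (Var i) = e i"
| "tval M e Zero = zer M"
| "tval M e One = one M"
| "tval M e (Add s t) = add M (tval M e s) (tval M e t)"
| "tval M e (Mul s t) = mul M (tval M e s) (tval M e t)"
| "tval M e (Exp2 t) = exp2 M (tval M e t)"

text \<open>Truth of a \<open>\<Delta>\<^sub>0\<close>-formula in the level with set of numbers \<open>L\<close>.\<close>

fun sat :: "'n nsa_struct \<Rightarrow> 'n set \<Rightarrow> (nat \<Rightarrow> 'n) \<Rightarrow> (nat \<Rightarrow> 'n set) \<Rightarrow> delta0 \<Rightarrow> bool" where
  "sat M L e E (Eq s t) \<longleftrightarrow> tval M e s = tval M e t"
| "sat M L e E (Less s t) \<longleftrightarrow> lss M (tval M e s) (tval M e t)"
| "sat M L e E (Mem t j) \<longleftrightarrow> tval M e t \<in> E j"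
| "sat M L e E (Neg \<phi>) \<longleftrightarrow> \<not> sat M L e E \<phi>"
| "sat M L e E (Conj \<phi> \<psi>) \<longleftrightarrow> sat M L e E \<phi> \<and> sat M L e E \<psi>"
| "sat M L e E (BEx v t \<phi>) \<longleftrightarrow> (\<exists>x\<in>L. lss M x (tval M e t) \<and> sat M L (e(v := x)) E \<phi>)"

definition sat_std :: "'n nsa_struct \<Rightarrow> (nat \<Rightarrow> 'n) \<Rightarrow> (nat \<Rightarrow> 'n set) \<Rightarrow> delta0 \<Rightarrow> bool" where
  "sat_std M e E \<phi> \<longleftrightarrow> sat M (stdN M) e E \<phi>"

text \<open>The star image of \<open>\<phi>\<close>; the values \<open>E\<close> of the set variables are standard sets.\<close>

definition sat_star :: "'n nsa_struct \<Rightarrow> (nat \<Rightarrow> 'n) \<Rightarrow> (nat \<Rightarrow> 'n set) \<Rightarrow> delta0 \<Rightarrow> bool" where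
  "sat_star M e E \<phi> \<longleftrightarrow> sat M UNIV e (star M \<circ> E) \<phi>"

definition asg :: "'n set \<Rightarrow> 'n set set \<Rightarrow> ((nat \<Rightarrow> 'n) \<times> (nat \<Rightarrow> 'n set)) set" where
  "asg L S = {(e, E). range e \<subseteq> L \<and> range E \<subseteq> S}"

abbreviation std_asg :: "'n nsa_struct \<Rightarrow> ((nat \<Rightarrow> 'n) \<times> (nat \<Rightarrow> 'n set)) set" where
  "std_asg M \<equiv> asg (stdN M) (stdP M)"

fun tvars :: "trm \<Rightarrow> nat set" where
  "tvars (Var i) = {i}"
| "tvars Zero = {}"
| "tvars One = {}"
| "tvars (Add s t) = tvars s \<union> tvars t"
| "tvars (Mul s t) = tvars s \<union> tvars t"
| "tvars (Exp2 t) = tvars t"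

fun fvn :: "delta0 \<Rightarrow> nat set" where
  "fvn (Eq s t) = tvars s \<union> tvars t"
| "fvn (Less s t) = tvars s \<union> tvars t"
| "fvn (Mem t j) = tvars t"
| "fvn (Neg \<phi>) = fvn \<phi>"
| "fvn (Conj \<phi> \<psi>) = fvn \<phi> \<union> fvn \<psi>"
| "fvn (BEx v t \<phi>) = tvars t \<union> (fvn \<phi> - {v})"

fun fvs :: "delta0 \<Rightarrow> nat set" where
  "fvs (Eq s t) = {}"
| "fvs (Less s t) = {}"
| "fvs (Mem t j) = {j}"
| "fvs (Neg \<phi>) = fvs \<phi>"
| "fvs (Conj \<phi> \<psi>) = fvs \<phi> \<union> fvs \<psi>"
| "fvs (BEx v t \<phi>) = fvs \<phi>"

section \<open>The system NSA\<close>

text \<open>The nonnegative parts of discretely ordered rings, with the recursion equations for \<open>2\<^sup>x\<close>.\<close>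

definition PA_minus :: "'n nsa_struct \<Rightarrow> 'n set \<Rightarrow> bool" where
  "PA_minus M L \<longleftrightarrow>
     zer M \<in> L \<and> one M \<in> L \<and>
     (\<forall>x\<in>L. \<forall>y\<in>L. add M x y \<in> L \<and> mul M x y \<in> L) \<and> (\<forall>x\<in>L. exp2 M x \<in> L) \<and>
     (\<forall>x\<in>L. \<forall>y\<in>L. \<forall>z\<in>L.
        add M (add M x y) z = add M x (add M y z) \<and>
        mul M (mul M x y) z = mul M x (mul M y z) \<and>
        mul M x (add M y z) = add M (mul M x y) (mul M x z) \<and>
        (lss M x y \<and> lss M y z \<longrightarrow> lss M x z) \<and>
        (lss M x y \<longrightarrow> lss M (add M x z) (add M y z)) \<and>
        (lss M (zer M) z \<and> lss M x y \<longrightarrow> lss M (mul M x z) (mul M y z))) \<and>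
     (\<forall>x\<in>L. \<forall>y\<in>L.
        add M x y = add M y x \<and> mul M x y = mul M y x \<and>
        (lss M x y \<or> x = y \<or> lss M y x) \<and>
        (lss M x y \<longrightarrow> (\<exists>z\<in>L. add M x z = y))) \<and>
     (\<forall>x\<in>L.
        add M x (zer M) = x \<and> mul M x (zer M) = zer M \<and> mul M x (one M) = x \<and>
        \<not> lss M x x \<and>
        (x = zer M \<or> lss M (zer M) x) \<and>
        (lss M (zer M) x \<longrightarrow> x = one M \<or> lss M (one M) x) \<and>
        exp2 M (add M x (one M)) = add M (exp2 M x) (exp2 M x)) \<and>
     lss M (zer M) (one M) \<and> exp2 M (zer M) = one M"

definition Sigma1_induction :: "'n nsa_struct \<Rightarrow> 'n set \<Rightarrow> 'n set set \<Rightarrow> bool" where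
  "Sigma1_induction M L S \<longleftrightarrow>
     (\<forall>\<phi> v w. \<forall>(e, E) \<in> asg L S.
        let P = (\<lambda>x. \<exists>y\<in>L. sat M L (e(v := x, w := y)) E \<phi>)
        in P (zer M) \<and> (\<forall>x\<in>L. P x \<longrightarrow> P (add M x (one M))) \<longrightarrow> (\<forall>x\<in>L. P x))"

definition ISigma1 :: "'n nsa_struct \<Rightarrow> 'n set \<Rightarrow> 'n set set \<Rightarrow> bool" where
  "ISigma1 M L S \<longleftrightarrow> PA_minus M L \<and> Sigma1_induction M L S"

definition end_extension :: "'n nsa_struct \<Rightarrow> 'n set \<Rightarrow> 'n set \<Rightarrow> bool" where
  "end_extension M L L' \<longleftrightarrow> L \<subset> L' \<and> (\<forall>x\<in>L. \<forall>y\<in>L'. lss M y x \<longrightarrow> y \<in> L)"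

text \<open>Since numbers are embedded by inclusion, a homomorphism amounts to closure of the
  smaller level under the operations together with preservation of membership.\<close>

definition embedding ::
  "'n nsa_struct \<Rightarrow> 'n set \<Rightarrow> 'n set set \<Rightarrow> 'n set set \<Rightarrow> ('n set \<Rightarrow> 'n set) \<Rightarrow> bool" where
  "embedding M L S S' \<sigma> \<longleftrightarrow>
     zer M \<in> L \<and> one M \<in> L \<and>
     (\<forall>x\<in>L. \<forall>y\<in>L. add M x y \<in> L \<and> mul M x y \<in> L) \<and> (\<forall>x\<in>L. exp2 M x \<in> L) \<and>
     \<sigma> ` S \<subseteq> S' \<and> inj_on \<sigma> S \<and> (\<forall>X\<in>S. \<forall>x\<in>L. x \<in> X \<longleftrightarrow> x \<in> \<sigma> X)"

definition Delta0_TRANS ::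
  "'n nsa_struct \<Rightarrow> 'n set \<Rightarrow> 'n set set \<Rightarrow> 'n set \<Rightarrow> ('n set \<Rightarrow> 'n set) \<Rightarrow> bool" where
  "Delta0_TRANS M L S L' \<sigma> \<longleftrightarrow>
     (\<forall>\<phi>. \<forall>(e, E) \<in> asg L S. sat M L e E \<phi> \<longleftrightarrow> sat M L' e (\<sigma> \<circ> E) \<phi>)"

definition Delta0_underspill ::
  "'n nsa_struct \<Rightarrow> 'n set \<Rightarrow> 'n set \<Rightarrow> 'n set set \<Rightarrow> bool" where
  "Delta0_underspill M L L' S' \<longleftrightarrow>
     (\<forall>\<phi> v. \<forall>(e, E) \<in> asg L S'.
        (\<forall>\<omega>\<in>L' - L. sat M L' (e(v := \<omega>)) E \<phi>) \<longrightarrow> (\<exists>m\<in>L. sat M L' (e(v := m)) E \<phi>))"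

definition Omega_CA :: "'n nsa_struct \<Rightarrow> bool" where
  "Omega_CA M \<longleftrightarrow>
     (\<forall>\<psi> v w. \<forall>(e, E) \<in> std_asg M. \<forall>\<omega> \<in> Omega M. v \<noteq> w \<longrightarrow>
        (\<forall>n\<in>stdN M. \<forall>\<omega>' \<in> Omega M.
           sat_star M (e(v := n, w := \<omega>)) E \<psi> \<longleftrightarrow> sat_star M (e(v := n, w := \<omega>')) E \<psi>) \<longrightarrow>
        (\<exists>X\<in>stdP M. \<forall>n\<in>stdN M. sat_star M (e(v := n, w := \<omega>)) E \<psi> \<longleftrightarrow> n \<in> X))"

definition set_sort :: "'n set \<Rightarrow> 'n set set \<Rightarrow> bool" where
  "set_sort L S \<longleftrightarrow> S \<noteq> {} \<and> S \<subseteq> Pow L"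

definition NSA_axioms :: "'n nsa_struct \<Rightarrow> bool" where
  "NSA_axioms M \<longleftrightarrow>
     set_sort (stdN M) (stdP M) \<and> set_sort (midN M) (midP M) \<and> set_sort UNIV (extP M) \<and>
     ISigma1 M (stdN M) (stdP M) \<and> ISigma1 M UNIV (extP M) \<and>
     end_extension M (stdN M) (midN M) \<and> end_extension M (midN M) UNIV \<and>
     embedding M (stdN M) (stdP M) (midP M) (up0 M) \<and>
     embedding M (midN M) (midP M) (extP M) (up1 M) \<and>
     Omega_CA M \<and>
     Delta0_TRANS M (stdN M) (stdP M) UNIV (star M) \<and>
     Delta0_TRANS M (stdN M) (stdP M) (midN M) (up0 M) \<and>
     Delta0_TRANS M (midN M) (midP M) UNIV (up1 M) \<and>
     Delta0_underspill M (stdN M) UNIV (extP M) \<and>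
     Delta0_underspill M (stdN M) (midN M) (midP M) \<and>
     Delta0_underspill M (midN M) UNIV (extP M)"

definition all_std :: "'n nsa_struct \<Rightarrow> nat \<Rightarrow> delta0 \<Rightarrow> bool" where
  "all_std M v \<phi> \<longleftrightarrow> (\<forall>(e, E) \<in> std_asg M. \<forall>n\<in>stdN M. sat_std M (e(v := n)) E \<phi>)"

definition all_star :: "'n nsa_struct \<Rightarrow> nat \<Rightarrow> delta0 \<Rightarrow> bool" where
  "all_star M v \<phi> \<longleftrightarrow> (\<forall>(e, E) \<in> std_asg M. \<forall>n. sat_star M (e(v := n)) E \<phi>)"

text \<open>
  The transfer rule.  \<open>transfer_rule v \<phi>\<close> says that the system proves \<open>(\<forall>v \<in> \<nat>) \<phi>\<close>,
  hence also \<open>(\<forall>v \<in> *\<nat>) *\<phi>\<close>; the premises may use conclusions \<open>\<Gamma>\<close> of earlier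
  applications of the rule.  The axioms being first-order schemata in a countable language,
  provability is truth in all models on the type \<^typ>\<open>nat\<close>, by the completeness and
  Loewenheim-Skolem theorems.
\<close>

inductive transfer_rule :: "nat \<Rightarrow> delta0 \<Rightarrow> bool" where
  "\<lbrakk>\<And>w \<chi>. (w, \<chi>) \<in> \<Gamma> \<Longrightarrow> transfer_rule w \<chi>;
    \<And>M :: nat nsa_struct. \<lbrakk>NSA_axioms M; \<forall>(w, \<chi>) \<in> \<Gamma>. all_star M w \<chi>\<rbrakk> \<Longrightarrow> all_std M v \<phi>\<rbrakk>
   \<Longrightarrow> transfer_rule v \<phi>"

definition NSA :: "'n nsa_struct \<Rightarrow> bool" where
  "NSA M \<longleftrightarrow> NSA_axioms M \<and> (\<forall>v \<phi>. transfer_rule v \<phi> \<longrightarrow> all_star M v \<phi>)"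

section \<open>Hyperconnectives\<close>

datatype hform =
    ExN nat delta0            \<comment> \<open>\<open>(\<exists>v \<in> \<nat>) \<phi>\<close>\<close>
  | AllN nat delta0           \<comment> \<open>\<open>(\<forall>v \<in> \<nat>) \<phi>\<close>\<close>
  | ExN1 nat delta0           \<comment> \<open>\<open>(\<exists>v \<in> \<nat>\<^sub>1) \<phi>\<close>\<close>
  | ExS nat delta0            \<comment> \<open>\<open>(\<exists>v \<in> *\<nat>) \<phi>\<close>\<close>
  | AllS nat delta0           \<comment> \<open>\<open>(\<forall>v \<in> *\<nat>) \<phi>\<close>\<close>
  | AllExN nat nat delta0     \<comment> \<open>\<open>(\<forall>v \<in> \<nat>)(\<exists>w \<in> \<nat>) \<phi>\<close>\<close>
  | ExAllS nat nat delta0     \<comment> \<open>\<open>(\<exists>v \<in> *\<nat>)(\<forall>w \<in> *\<nat>) \<phi>\<close>\<close>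
  | Absurd                    \<comment> \<open>\<open>0 = 1\<close>\<close>
  | HImp hform hform          \<comment> \<open>hyperimplication\<close>

definition HNot :: "hform \<Rightarrow> hform" where
  "HNot A = HImp A Absurd"

definition rel_finite :: "'n nsa_struct \<Rightarrow> 'n \<Rightarrow> 'n \<Rightarrow> bool" where
  "rel_finite M n m \<longleftrightarrow> (n \<in> stdN M \<longrightarrow> m \<in> stdN M) \<and> (n \<in> midN M \<longrightarrow> m \<in> midN M)"

text \<open>
  The prenex form under which a hypernegation is considered for membership in \<open>\<T>\<close>: since
  \<open>A \<and> A \<in> \<T>\<close> is \<open>(\<exists>v \<in> \<nat>) \<phi>\<close> for \<open>A = (\<exists>v \<in> \<nat>) \<phi>\<close>, its hypernegation is
  \<open>(\<forall>v \<in> \<nat>) \<not>\<phi>\<close>; since \<open>A \<and> A \<in> \<T>\<close> is \<open>(\<forall>v \<in> *\<nat>) \<phi>\<close> for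
  \<open>A = (\<forall>v \<in> \<nat>) \<phi>\<close> and for \<open>A = (\<forall>v \<in> *\<nat>) \<phi>\<close>, the hypernegation of both is
  \<open>(\<exists>v \<in> *\<nat>) \<not>\<phi>\<close>.
\<close>

fun prenex :: "hform \<Rightarrow> hform" where
  "prenex (HImp A B) =
     (case (prenex A, prenex B) of
        (ExN v \<phi>, Absurd) \<Rightarrow> AllN v (Neg \<phi>)
      | (AllN v \<phi>, Absurd) \<Rightarrow> ExS v (Neg \<phi>)
      | (AllS v \<phi>, Absurd) \<Rightarrow> ExS v (Neg \<phi>)
      | _ \<Rightarrow> HImp A B)"
| "prenex A = A"

fun in_T_prenex ::
  "'n nsa_struct \<Rightarrow> (nat \<Rightarrow> 'n) \<Rightarrow> (nat \<Rightarrow> 'n set) \<Rightarrow> hform \<Rightarrow> bool" where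
  "in_T_prenex M e E (AllN v \<phi>) \<longleftrightarrow>
     (\<forall>n\<in>stdN M. sat_std M (e(v := n)) E \<phi>) \<longrightarrow> (\<forall>n. sat_star M (e(v := n)) E \<phi>)"
| "in_T_prenex M e E (ExS v \<phi>) \<longleftrightarrow>
     (\<exists>n. sat_star M (e(v := n)) E \<phi>) \<longrightarrow> (\<exists>n\<in>midN M. sat_star M (e(v := n)) E \<phi>)"
| "in_T_prenex M e E (AllExN v w \<phi>) \<longleftrightarrow>
     (\<forall>n\<in>stdN M. \<exists>m\<in>stdN M. sat_std M (e(v := n, w := m)) E \<phi>) \<longrightarrow>
     (\<forall>n. \<exists>m. rel_finite M n m \<and> sat_star M (e(v := n, w := m)) E \<phi>)"
| "in_T_prenex M e E (ExAllS v w \<phi>) \<longleftrightarrow>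
     (\<exists>n. \<forall>m. sat_star M (e(v := n, w := m)) E \<phi>) \<longrightarrow>
     (\<exists>n\<in>midN M. \<forall>m. sat_star M (e(v := n, w := m)) E \<phi>)"
| "in_T_prenex M e E _ \<longleftrightarrow> True"

definition in_T :: "'n nsa_struct \<Rightarrow> (nat \<Rightarrow> 'n) \<Rightarrow> (nat \<Rightarrow> 'n set) \<Rightarrow> hform \<Rightarrow> bool" where
  "in_T M e E A \<longleftrightarrow> in_T_prenex M e E (prenex A)"

fun holds :: "'n nsa_struct \<Rightarrow> (nat \<Rightarrow> 'n) \<Rightarrow> (nat \<Rightarrow> 'n set) \<Rightarrow> hform \<Rightarrow> bool" where
  "holds M e E (ExN v \<phi>) \<longleftrightarrow> (\<exists>n\<in>stdN M. sat_std M (e(v := n)) E \<phi>)"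
| "holds M e E (AllN v \<phi>) \<longleftrightarrow> (\<forall>n\<in>stdN M. sat_std M (e(v := n)) E \<phi>)"
| "holds M e E (ExN1 v \<phi>) \<longleftrightarrow> (\<exists>n\<in>midN M. sat_star M (e(v := n)) E \<phi>)"
| "holds M e E (ExS v \<phi>) \<longleftrightarrow> (\<exists>n. sat_star M (e(v := n)) E \<phi>)"
| "holds M e E (AllS v \<phi>) \<longleftrightarrow> (\<forall>n. sat_star M (e(v := n)) E \<phi>)"
| "holds M e E (AllExN v w \<phi>) \<longleftrightarrow>
     (\<forall>n\<in>stdN M. \<exists>m\<in>stdN M. sat_std M (e(v := n, w := m)) E \<phi>)"
| "holds M e E (ExAllS v w \<phi>) \<longleftrightarrow> (\<exists>n. \<forall>m. sat_star M (e(v := n, w := m)) E \<phi>)"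
| "holds M e E Absurd \<longleftrightarrow> zer M = one M"
| "holds M e E (HImp A B) \<longleftrightarrow> (holds M e E A \<and> in_T M e E A \<longrightarrow> holds M e E B \<and> in_T M e E B)"

fun hfvn :: "hform \<Rightarrow> nat set" where
  "hfvn (ExN v \<phi>) = fvn \<phi> - {v}"
| "hfvn (AllN v \<phi>) = fvn \<phi> - {v}"
| "hfvn (ExN1 v \<phi>) = fvn \<phi> - {v}"
| "hfvn (ExS v \<phi>) = fvn \<phi> - {v}"
| "hfvn (AllS v \<phi>) = fvn \<phi> - {v}"
| "hfvn (AllExN v w \<phi>) = fvn \<phi> - {v, w}"
| "hfvn (ExAllS v w \<phi>) = fvn \<phi> - {v, w}"
| "hfvn Absurd = {}"
| "hfvn (HImp A B) = hfvn A \<union> hfvn B"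

fun hfvs :: "hform \<Rightarrow> nat set" where
  "hfvs (ExN v \<phi>) = fvs \<phi>"
| "hfvs (AllN v \<phi>) = fvs \<phi>"
| "hfvs (ExN1 v \<phi>) = fvs \<phi>"
| "hfvs (ExS v \<phi>) = fvs \<phi>"
| "hfvs (AllS v \<phi>) = fvs \<phi>"
| "hfvs (AllExN v w \<phi>) = fvs \<phi>"
| "hfvs (ExAllS v w \<phi>) = fvs \<phi>"
| "hfvs Absurd = {}"
| "hfvs (HImp A B) = hfvs A \<union> hfvs B"

text \<open>
  The parameters of \<open>A\<close> and \<open>B\<close> are their free variables \<open>V\<close>, \<open>W\<close>; they range over
  the values they take in the assignments in \<open>D\<close>.  All other variables of \<open>\<psi>\<close> except
  \<open>m\<close> denote fixed standard parameters, given by \<open>(e\<^sub>0, E\<^sub>0)\<close>.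
\<close>

definition Omega_invariant ::
  "'n nsa_struct \<Rightarrow> ((nat \<Rightarrow> 'n) \<times> (nat \<Rightarrow> 'n set)) set \<Rightarrow>
   ((nat \<Rightarrow> 'n) \<Rightarrow> (nat \<Rightarrow> 'n set) \<Rightarrow> 'n \<Rightarrow> bool) \<Rightarrow> 'n \<Rightarrow> bool" where
  "Omega_invariant M D \<Psi> \<omega> \<longleftrightarrow>
     \<omega> \<in> Omega M \<and> (\<forall>(e, E) \<in> D. \<forall>\<omega>' \<in> Omega M. \<Psi> e E \<omega> \<longleftrightarrow> \<Psi> e E \<omega>')"

definition oplus ::
  "'n nsa_struct \<Rightarrow> ((nat \<Rightarrow> 'n) \<times> (nat \<Rightarrow> 'n set)) set \<Rightarrow> hform \<Rightarrow> hform \<Rightarrow> bool" where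
  "oplus M D A B \<longleftrightarrow>
     (let V = hfvn A \<union> hfvn B; W = hfvs A \<union> hfvs B in
      \<exists>\<psi> m \<omega>. \<exists>(e\<^sub>0, E\<^sub>0) \<in> std_asg M.
        m \<notin> V \<and>
        (let \<Psi> = (\<lambda>e E x. sat_star M ((override_on e\<^sub>0 e V)(m := x)) (override_on E\<^sub>0 E W) \<psi>) in
         Omega_invariant M D \<Psi> \<omega> \<and>
         (\<forall>(e, E) \<in> D.
            (\<Psi> e E \<omega> \<longrightarrow> holds M e E A \<and> in_T M e E A) \<and>
            (\<not> \<Psi> e E \<omega> \<longrightarrow> holds M e E B \<and> in_T M e E B))))"

definition LPO :: "'n nsa_struct \<Rightarrow> bool" where
  "LPO M \<longleftrightarrow> (\<forall>v \<phi>. oplus M (std_asg M) (ExN v \<phi>) (HNot (ExN v \<phi>)))"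

section \<open>Real numbers\<close>

text \<open>The triple \<open>(a, b, c)\<close> of natural numbers with \<open>c \<noteq> 0\<close> stands for the rational \<open>(a - b) / c\<close>.\<close>

fun rat_less :: "'n nsa_struct \<Rightarrow> 'n \<times> 'n \<times> 'n \<Rightarrow> 'n \<times> 'n \<times> 'n \<Rightarrow> bool" where
  "rat_less M (a, b, c) (a', b', c') \<longleftrightarrow>
     lss M (add M (mul M a c') (mul M b' c)) (add M (mul M a' c) (mul M b c'))"

fun rat_diff :: "'n nsa_struct \<Rightarrow> 'n \<times> 'n \<times> 'n \<Rightarrow> 'n \<times> 'n \<times> 'n \<Rightarrow> 'n \<times> 'n \<times> 'n" where
  "rat_diff M (a, b, c) (a', b', c') =
     (add M (mul M a c') (mul M b' c), add M (mul M b c') (mul M a' c), mul M c c')"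

definition rat_exp2_neg :: "'n nsa_struct \<Rightarrow> 'n \<Rightarrow> 'n \<times> 'n \<times> 'n" where
  "rat_exp2_neg M k = (one M, zer M, exp2 M k)"

text \<open>
  A sequence of rationals is given by a \<open>\<Delta>\<^sub>0\<close>-formula \<open>\<theta>\<close>, with standard numbers and sets
  as parameters, such that \<open>\<theta>(n, a, b, c)\<close> defines the graph of \<open>n \<mapsto> q\<^sub>n = (a - b) / c\<close>
  on \<open>\<nat>\<close>; its star image is the one of \<open>\<theta>\<close>.  Sequences coded by a standard set are the
  instances in which \<open>\<theta>\<close> expresses membership of a code of \<open>(n, a, b, c)\<close> in that set.
\<close>

record rseq =
  graph :: delta0
  nv :: nat
  av :: nat
  bv :: nat
  cv :: nat

definition wf_rseq :: "rseq \<Rightarrow> bool" where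
  "wf_rseq x \<longleftrightarrow> distinct [nv x, av x, bv x, cv x]"

fun seq_val ::
  "'n nsa_struct \<Rightarrow> (nat \<Rightarrow> 'n) \<Rightarrow> (nat \<Rightarrow> 'n set) \<Rightarrow> rseq \<Rightarrow> 'n \<Rightarrow> 'n \<times> 'n \<times> 'n \<Rightarrow> bool" where
  "seq_val M e E x n (a, b, c) \<longleftrightarrow>
     a \<in> stdN M \<and> b \<in> stdN M \<and> c \<in> stdN M \<and>
     sat_std M (e(nv x := n, av x := a, bv x := b, cv x := c)) E (graph x)"

definition rational_sequence ::
  "'n nsa_struct \<Rightarrow> (nat \<Rightarrow> 'n) \<Rightarrow> (nat \<Rightarrow> 'n set) \<Rightarrow> rseq \<Rightarrow> bool" where
  "rational_sequence M e E x \<longleftrightarrow>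
     (\<forall>n\<in>stdN M. (\<exists>!q. seq_val M e E x n q) \<and>
        (\<forall>a b c. seq_val M e E x n (a, b, c) \<longrightarrow> c \<noteq> zer M))"

definition is_real :: "'n nsa_struct \<Rightarrow> (nat \<Rightarrow> 'n) \<Rightarrow> (nat \<Rightarrow> 'n set) \<Rightarrow> rseq \<Rightarrow> bool" where
  "is_real M e E x \<longleftrightarrow>
     rational_sequence M e E x \<and>
     (\<forall>k\<in>stdN M. \<forall>i\<in>stdN M. \<forall>q q'.
        seq_val M e E x k q \<and> seq_val M e E x (add M k i) q' \<longrightarrow>
        rat_less M (rat_diff M q q') (rat_exp2_neg M k) \<and>
        rat_less M (rat_diff M q' q) (rat_exp2_neg M k))"

text \<open>
  \<open>x > 0\<close>, that is \<open>(\<exists>n \<in> \<nat>)(q\<^sub>n > 2\<^sup>-\<^sup>n)\<close>.  As the value \<open>q\<^sub>n = (a - b) / c\<close> is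
  referred to through the graph, the existential quantifiers over \<open>n, a, b, c\<close> are contracted
  to a single one over a bound \<open>u\<close> to obtain a \<open>\<Sigma>\<^sub>1\<close>-formula;
  \<open>q\<^sub>n > 2\<^sup>-\<^sup>n\<close> reads \<open>1 \<cdot> c + b \<cdot> 2\<^sup>n < a \<cdot> 2\<^sup>n\<close>.
\<close>

definition positive :: "rseq \<Rightarrow> hform" where
  "positive x =
     (let n = nv x; a = av x; b = bv x; c = cv x;
          u = (LEAST u. u \<notin> fvn (graph x) \<union> {n, a, b, c})
      in ExN u (BEx n (Var u) (BEx a (Var u) (BEx b (Var u) (BEx c (Var u)
           (Conj (graph x)
             (Less (Add (Mul One (Var c)) (Mul (Var b) (Exp2 (Var n))))
                   (Mul (Var a) (Exp2 (Var n))))))))))"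

definition LPR :: "'n nsa_struct \<Rightarrow> bool" where
  "LPR M \<longleftrightarrow>
     (\<forall>x. wf_rseq x \<longrightarrow>
        oplus M {(e, E) \<in> std_asg M. is_real M e E x} (positive x) (HNot (positive x)))"

end

theory Submission
  imports Defs
begin

text \<open>
  \<open>LPO\<close> yields \<open>LPR\<close> because \<open>x > 0\<close> is itself a \<open>\<Sigma>\<^sub>1\<close>-formula.  For the converse,
  given \<open>(\<exists>v) \<phi>(v)\<close>, let \<open>q\<^sub>n = 2\<^sup>-\<^sup>k\<close> where \<open>k\<close> is the least number with
  \<open>k = n \<or> \<phi>(k)\<close>.  This is a real for all values of the parameters, it has the same parameters
  as \<open>(\<exists>v) \<phi>\<close>, and \<open>q\<^sub>n > 2\<^sup>-\<^sup>n\<close> holds exactly when some \<open>k < n\<close> satisfies \<open>\<phi>\<close>.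
  The least number principle in \<open>*\<nat>\<close> gives the same equivalence there, so that the transfer
  of \<open>\<not> x > 0\<close> provided by the hypernegation amounts to the transfer of \<open>(\<forall>v) \<not> \<phi>\<close>.
\<close>

section \<open>Free variables and the coincidence lemma\<close>

lemma finite_tvars: "finite (tvars t)"
  by (induction t) auto

lemma finite_fvn: "finite (fvn \<phi>)"
  by (induction \<phi>) (auto simp: finite_tvars)

lemma tval_cong: "(\<And>i. i \<in> tvars t \<Longrightarrow> e i = e' i) \<Longrightarrow> tval M e t = tval M e' t"
  by (induction t) auto

lemma sat_cong: "(\<And>i. i \<in> fvn \<phi> \<Longrightarrow> e i = e' i) \<Longrightarrow> sat M L e E \<phi> \<longleftrightarrow> sat M L e' E \<phi>"
proof (induction \<phi> arbitrary: e e')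
  case (Eq s t)
  then show ?case using tval_cong[of s e e' M] tval_cong[of t e e' M] by simp
next
  case (Less s t)
  then show ?case using tval_cong[of s e e' M] tval_cong[of t e e' M] by simp
next
  case (Mem t j)
  then show ?case using tval_cong[of t e e' M] by simp
next
  case (Neg \<phi>)
  show ?case using Neg.IH[of e e'] Neg.prems by simp
next
  case (Conj \<phi> \<psi>)
  show ?case using Conj.IH(1)[of e e'] Conj.IH(2)[of e e'] Conj.prems by simp
next
  case (BEx v t \<phi>)
  have "tval M e t = tval M e' t" using BEx.prems by (intro tval_cong) simp
  moreover have "sat M L (e(v := x)) E \<phi> \<longleftrightarrow> sat M L (e'(v := x)) E \<phi>" for x
    using BEx.prems by (intro BEx.IH) simp
  ultimately show ?case by simp
qed

section \<open>Arithmetic in models of \<open>I\<Sigma>\<^sub>1\<close>\<close>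

locale isigma1 =
  fixes M :: "'n nsa_struct" and L :: "'n set" and S :: "'n set set"
  assumes isigma1: "ISigma1 M L S"
begin

lemma pa: "PA_minus M L"
  using isigma1 by (simp add: ISigma1_def)

lemma closed [simp]:
  "zer M \<in> L" "one M \<in> L" "x \<in> L \<Longrightarrow> y \<in> L \<Longrightarrow> add M x y \<in> L"
  "x \<in> L \<Longrightarrow> y \<in> L \<Longrightarrow> mul M x y \<in> L" "x \<in> L \<Longrightarrow> exp2 M x \<in> L"
  using pa by (simp_all add: PA_minus_def)

lemmas pa_conjuncts = pa[unfolded PA_minus_def, THEN conjunct2, THEN conjunct2, THEN conjunct2, THEN conjunct2]
lemmas pa_ternary = pa_conjuncts[THEN conjunct1]
  and pa_binary = pa_conjuncts[THEN conjunct2, THEN conjunct1]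
  and pa_unary = pa_conjuncts[THEN conjunct2, THEN conjunct2, THEN conjunct1]

lemma
  assumes "x \<in> L" "y \<in> L"
  shows add_comm: "add M x y = add M y x"
    and mul_comm: "mul M x y = mul M y x"
    and lss_linear: "lss M x y \<or> x = y \<or> lss M y x"
    and lss_imp_add: "lss M x y \<Longrightarrow> \<exists>z\<in>L. add M x z = y"
  using pa_binary[rule_format, OF assms] by blast+

lemma
  assumes "x \<in> L" "y \<in> L" "z \<in> L"
  shows add_assoc: "add M (add M x y) z = add M x (add M y z)"
    and lss_trans: "lss M x y \<Longrightarrow> lss M y z \<Longrightarrow> lss M x z"
    and add_mono1: "lss M x y \<Longrightarrow> lss M (add M x z) (add M y z)"
    and mul_mono1: "lss M (zer M) z \<Longrightarrow> lss M x y \<Longrightarrow> lss M (mul M x z) (mul M y z)"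
  using pa_ternary[rule_format, OF assms] by blast+

lemma zer_lss_one [simp]: "lss M (zer M) (one M)" and exp2_zer [simp]: "exp2 M (zer M) = one M"
  using pa by (simp_all add: PA_minus_def)

lemma
  assumes "x \<in> L"
  shows add_zer [simp]: "add M x (zer M) = x"
    and mul_zer [simp]: "mul M x (zer M) = zer M"
    and mul_one [simp]: "mul M x (one M) = x"
    and lss_irrefl [simp]: "\<not> lss M x x"
    and zer_or_pos: "x = zer M \<or> lss M (zer M) x"
    and pos_one: "lss M (zer M) x \<Longrightarrow> x = one M \<or> lss M (one M) x"
    and exp2_add_one: "exp2 M (add M x (one M)) = add M (exp2 M x) (exp2 M x)"
  using pa_unary[rule_format, OF assms] by blast+

lemma zer_add [simp]: "x \<in> L \<Longrightarrow> add M (zer M) x = x"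
  and zer_mul [simp]: "x \<in> L \<Longrightarrow> mul M (zer M) x = zer M"
  and one_mul [simp]: "x \<in> L \<Longrightarrow> mul M (one M) x = x"
  by (simp_all add: add_comm[of "zer M"] mul_comm[of "zer M"] mul_comm[of "one M"])

lemma zer_neq_one: "zer M \<noteq> one M"
  using zer_lss_one lss_irrefl[OF closed(2)] by metis

lemma add_pos: "x \<in> L \<Longrightarrow> y \<in> L \<Longrightarrow> lss M (zer M) y \<Longrightarrow> lss M x (add M x y)"
  using add_mono1[of "zer M" y x] by (simp add: add_comm[of y x])

lemma mul_pos:
  "x \<in> L \<Longrightarrow> y \<in> L \<Longrightarrow> lss M (zer M) x \<Longrightarrow> lss M (zer M) y \<Longrightarrow> lss M (zer M) (mul M x y)"
  using mul_mono1[of "zer M" x y] by simp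

lemma lss_asym: "x \<in> L \<Longrightarrow> y \<in> L \<Longrightarrow> lss M x y \<Longrightarrow> \<not> lss M y x"
  using lss_trans[of x y x] by auto

lemma add_not_lss: "x \<in> L \<Longrightarrow> z \<in> L \<Longrightarrow> \<not> lss M (add M x z) x"
  using zer_or_pos[of z] add_pos[of x z] lss_asym[of x "add M x z"] by auto

text \<open>Discreteness of the order: a positive difference is at least
  \<open>one M\<close>.\<close>

lemma lss_add_one_iff:
  assumes "x \<in> L" "y \<in> L"
  shows "lss M y (add M x (one M)) \<longleftrightarrow> lss M y x \<or> y = x"
proof
  assume less: "lss M y (add M x (one M))"
  show "lss M y x \<or> y = x"
  proof (rule ccontr)
    assume "\<not> ?thesis"
    then have "lss M x y" using lss_linear assms by blast
    then obtain z where z: "z \<in> L" "add M x z = y" using lss_imp_add assms by blast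
    have "z \<noteq> zer M" using z \<open>lss M x y\<close> assms by auto
    then have "z = one M \<or> lss M (one M) z" using zer_or_pos pos_one z by blast
    then have "y = add M x (one M) \<or> lss M (add M x (one M)) y"
      using add_mono1[of "one M" z x] z assms by (auto simp: add_comm[of _ x])
    then show False using less lss_asym[of y "add M x (one M)"] assms by auto
  qed
next
  assume "lss M y x \<or> y = x"
  then show "lss M y (add M x (one M))"
    using add_pos[of x "one M"] lss_trans[of y x "add M x (one M)"] assms by auto
qed

lemma upper_bound:
  assumes "x \<in> L" "y \<in> L"
  shows "\<exists>u\<in>L. lss M x u \<and> lss M y u"
proof -
  have "\<exists>w\<in>L. (lss M x w \<or> x = w) \<and> (lss M y w \<or> y = w)"
    using lss_linear assms by blast
  then show ?thesis using lss_add_one_iff assms closed by metis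
qed

section \<open>Induction and least number principle for bounded formulas\<close>

lemma delta0_induct:
  assumes e: "range e \<subseteq> L" "range E \<subseteq> S"
    and base: "sat M L (e(v := zer M)) E \<phi>"
    and step: "\<And>x. x \<in> L \<Longrightarrow> sat M L (e(v := x)) E \<phi> \<Longrightarrow> sat M L (e(v := add M x (one M))) E \<phi>"
    and "x \<in> L"
  shows "sat M L (e(v := x)) E \<phi>"
proof -
  have "finite (fvn \<phi> \<union> {v})" using finite_fvn by simp
  then obtain w where w: "w \<notin> fvn \<phi> \<union> {v}" using ex_new_if_finite infinite_UNIV_nat by blast
  \<comment> \<open>The induction scheme demands an unbounded existential quantifier. A fresh
    \<open>w\<close> makes it vacuous, and \<open>L\<close> is nonempty.\<close>
  have dummy: "sat M L (e(v := x, w := y)) E \<phi> \<longleftrightarrow> sat M L (e(v := x)) E \<phi>" for x y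
    using w by (intro sat_cong) auto
  have ne: "(\<exists>y\<in>L. Q) \<longleftrightarrow> Q" for Q using closed(1) by blast
  have "Sigma1_induction M L S" "(e, E) \<in> asg L S"
    using isigma1 e by (auto simp: ISigma1_def asg_def)
  then have "let P = (\<lambda>x. \<exists>y\<in>L. sat M L (e(v := x, w := y)) E \<phi>)
        in P (zer M) \<and> (\<forall>x\<in>L. P x \<longrightarrow> P (add M x (one M))) \<longrightarrow> (\<forall>x\<in>L. P x)"
    unfolding Sigma1_induction_def by blast
  then show ?thesis unfolding Let_def dummy ne using base step \<open>x \<in> L\<close> by blast
qed

text \<open>Without a least witness, induction on \<open>y\<close> shows that no number below
  \<open>y\<close> is a witness. This statement is again bounded, with a fresh variable
  \<open>z\<close> as the bound.\<close>

lemma delta0_least: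
  assumes e: "range e \<subseteq> L" "range E \<subseteq> S"
    and "x \<in> L" "sat M L (e(v := x)) E \<phi>"
  shows "\<exists>k\<in>L. sat M L (e(v := k)) E \<phi> \<and> (\<forall>j\<in>L. lss M j k \<longrightarrow> \<not> sat M L (e(v := j)) E \<phi>)"
proof (rule ccontr)
  assume none: "\<not> ?thesis"
  have "finite (fvn \<phi> \<union> {v})" using finite_fvn by simp
  then obtain z where z: "z \<notin> fvn \<phi> \<union> {v}" using ex_new_if_finite infinite_UNIV_nat by blast
  have drop: "sat M L (e(z := y, v := j)) E \<phi> \<longleftrightarrow> sat M L (e(v := j)) E \<phi>" for y j
    using z by (intro sat_cong) auto
  have below: "sat M L (e(z := y)) E (Neg (BEx v (Var z) \<phi>)) \<longleftrightarrow>
      (\<forall>j\<in>L. lss M j y \<longrightarrow> \<not> sat M L (e(v := j)) E \<phi>)" for y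
    using drop by auto
  have "sat M L (e(z := add M x (one M))) E (Neg (BEx v (Var z) \<phi>))"
  proof (rule delta0_induct[OF e])
    show "sat M L (e(z := zer M)) E (Neg (BEx v (Var z) \<phi>))"
      unfolding below using zer_or_pos lss_asym closed(1) lss_irrefl by metis
    show "sat M L (e(z := add M y (one M))) E (Neg (BEx v (Var z) \<phi>))"
      if "y \<in> L" "sat M L (e(z := y)) E (Neg (BEx v (Var z) \<phi>))" for y
      using that(2) none \<open>y \<in> L\<close> unfolding below by (auto simp: lss_add_one_iff)
  qed (use \<open>x \<in> L\<close> in simp)
  then show False unfolding below using assms add_pos[of x "one M"] by auto
qed

text \<open>Induction quantifies over assignments of set variables, hence needs some \<open>E0 \<in> S\<close>.\<close>

lemma exp2_pos: "x \<in> L \<Longrightarrow> E0 \<in> S \<Longrightarrow> lss M (zer M) (exp2 M x)"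
proof -
  assume "x \<in> L" "E0 \<in> S"
  have "sat M L ((\<lambda>_. zer M)(0 := x)) (\<lambda>_. E0) (Less Zero (Exp2 (Var 0)))"
  proof (rule delta0_induct)
    fix x
    assume "x \<in> L" "sat M L ((\<lambda>_. zer M)(0 := x)) (\<lambda>_. E0) (Less Zero (Exp2 (Var 0)))"
    then show "sat M L ((\<lambda>_. zer M)(0 := add M x (one M))) (\<lambda>_. E0) (Less Zero (Exp2 (Var 0)))"
      using add_pos[of "exp2 M x" "exp2 M x"]
        lss_trans[of "zer M" "exp2 M x" "add M (exp2 M x) (exp2 M x)"]
      by (simp add: exp2_add_one)
  qed (use \<open>x \<in> L\<close> \<open>E0 \<in> S\<close> in auto)
  then show ?thesis by simp
qed

lemma exp2_lss_exp2_add_one: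
  "x \<in> L \<Longrightarrow> E0 \<in> S \<Longrightarrow> lss M (exp2 M x) (exp2 M (add M x (one M)))"
  by (simp add: exp2_add_one add_pos exp2_pos)

lemma exp2_mono:
  assumes "x \<in> L" "z \<in> L" "E0 \<in> S"
  shows "\<not> lss M (exp2 M (add M x z)) (exp2 M x)"
proof -
  \<comment> \<open>Variable 0 carries the induction and variable 1 the fixed \<open>x\<close>. The
    negated form expresses the weak inequality.\<close>
  let ?\<phi> = "Neg (Less (Exp2 (Add (Var 1) (Var 0))) (Exp2 (Var 1)))"
  have "sat M L ((\<lambda>_. x)(0 := z)) (\<lambda>_. E0) ?\<phi>"
  proof (rule delta0_induct)
    fix y
    assume y: "y \<in> L" "sat M L ((\<lambda>_. x)(0 := y)) (\<lambda>_. E0) ?\<phi>"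
    have "lss M (exp2 M (add M x y)) (exp2 M (add M (add M x y) (one M)))"
      using exp2_lss_exp2_add_one[of "add M x y" E0] assms y by simp
    then show "sat M L ((\<lambda>_. x)(0 := add M y (one M))) (\<lambda>_. E0) ?\<phi>"
      using y assms lss_trans[of "exp2 M (add M x y)" "exp2 M (add M (add M x y) (one M))" "exp2 M x"]
      by (auto simp: add_assoc)
  qed (use assms in auto)
  then show ?thesis by simp
qed

end

section \<open>The real of a \<open>\<Sigma>\<^sub>1\<close>-formula\<close>

text \<open>The variables from \<open>N\<close> on are meant to be fresh for \<open>(\<exists>v) \<phi>\<close>.\<close>

definition least_seq :: "nat \<Rightarrow> delta0 \<Rightarrow> nat \<Rightarrow> rseq" where
  "least_seq v \<phi> N = \<lparr>graph =
     Conj (Eq (Var (N + 1)) One) (Conj (Eq (Var (N + 2)) Zero)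
       (BEx (N + 4) (Add (Var N) One)
         (Conj (Eq (Var (N + 3)) (Exp2 (Var (N + 4))))
           (Conj (Neg (BEx v (Var (N + 4)) \<phi>))
             (Neg (Conj (Neg (Eq (Var (N + 4)) (Var N)))
               (Neg (BEx v (Add (Var (N + 4)) One) (Conj (Eq (Var v) (Var (N + 4))) \<phi>))))))))),
     nv = N, av = N + 1, bv = N + 2, cv = N + 3\<rparr>"

lemma least_seq_sel [simp]:
  "nv (least_seq v \<phi> N) = N" "av (least_seq v \<phi> N) = N + 1"
  "bv (least_seq v \<phi> N) = N + 2" "cv (least_seq v \<phi> N) = N + 3"
  by (simp_all add: least_seq_def)

lemma wf_least_seq: "wf_rseq (least_seq v \<phi> N)"
  by (simp add: wf_rseq_def)

text \<open>The strict bound \<open>n + 1\<close> expresses \<open>k \<le> n\<close>. Together with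
  minimality it makes \<open>k\<close> the least number with \<open>k = n\<close> or
  \<open>F k\<close>.\<close>

definition least_index :: "'n nsa_struct \<Rightarrow> 'n set \<Rightarrow> ('n \<Rightarrow> bool) \<Rightarrow> 'n \<Rightarrow> 'n \<Rightarrow> bool" where
  "least_index M L F n k \<longleftrightarrow>
     k \<in> L \<and> lss M k (add M n (one M)) \<and> (\<forall>j\<in>L. lss M j k \<longrightarrow> \<not> F j) \<and> (k = n \<or> F k)"

locale fresh_isigma1 = isigma1 +
  fixes v :: nat and \<phi> :: delta0 and N :: nat
  assumes fresh: "\<forall>i \<in> fvn \<phi> \<union> {v}. i < N"
begin

lemma fvn_least_seq: "fvn (graph (least_seq v \<phi> N)) = {N, N + 1, N + 2, N + 3} \<union> (fvn \<phi> - {v})"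
  using fresh by (auto simp: least_seq_def)

lemma sat_graph:
  assumes "range e \<subseteq> L" "\<And>i. i < N \<Longrightarrow> e i = e\<^sub>0 i"
  shows "sat M L e E (graph (least_seq v \<phi> N)) \<longleftrightarrow>
     e (N + 1) = one M \<and> e (N + 2) = zer M \<and>
     (\<exists>k. least_index M L (\<lambda>j. sat M L (e\<^sub>0(v := j)) E \<phi>) (e N) k \<and> e (N + 3) = exp2 M k)"
proof -
  have v: "v < N" using fresh by simp
  have \<phi>: "sat M L (e(N + 4 := k, v := j)) E \<phi> \<longleftrightarrow> sat M L (e\<^sub>0(v := j)) E \<phi>" for j k
    using fresh assms(2) by (intro sat_cong) auto
  \<comment> \<open>The graph expresses that \<open>k\<close> satisfies \<open>\<phi>\<close>
    without substitution, by quantifying \<open>v\<close> below \<open>k + 1\<close> and requiring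
    \<open>v = k\<close>.\<close>
  have "\<exists>x\<in>L. lss M x (add M k (one M)) \<and> x = k \<and> F x" if "k \<in> L" "F k" for k F
    using that by (auto simp: lss_add_one_iff)
  then have single: "(\<exists>x\<in>L. lss M x (add M k (one M)) \<and> x = k \<and> F x) \<longleftrightarrow> F k" if "k \<in> L" for k F
    using that by blast
  show ?thesis
    using v unfolding least_seq_def least_index_def
    by (auto simp: \<phi>[simplified] single)
qed

lemma least_index_unique:
  assumes n: "n \<in> L" and k: "least_index M L F n k" "least_index M L F n k'"
  shows "k = k'"
proof -
  have *: "\<not> lss M k k'" if "least_index M L F n k" "least_index M L F n k'" for k k'
  proof
    assume less: "lss M k k'"
    \<comment> \<open>Otherwise \<open>F k\<close> would contradict the minimality of
      \<open>k'\<close>; and \<open>k = n\<close> contradicts \<open>k' \<le> n\<close>.\<close>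
    then have "k = n" using that by (auto simp: least_index_def)
    then show False using less that n lss_asym[of k k']
      by (auto simp: least_index_def lss_add_one_iff)
  qed
  show ?thesis
    using *[OF k] *[OF k(2,1)] lss_linear[of k k'] k by (auto simp: least_index_def)
qed

text \<open>The least number principle applies to the disjunction of \<open>j = n\<close> and
  \<open>\<phi>\<close>, which \<open>n\<close> itself satisfies.\<close>

lemma least_index_exists:
  assumes "range e \<subseteq> L" "range E \<subseteq> S" "n \<in> L"
  shows "\<exists>k. least_index M L (\<lambda>j. sat M L (e(v := j)) E \<phi>) n k"
proof -
  have v: "v < N" using fresh by simp
  let ?\<chi> = "Neg (Conj (Neg (Eq (Var v) (Var N))) (Neg \<phi>))"
  have drop: "sat M L (e(N := n, v := j)) E \<phi> \<longleftrightarrow> sat M L (e(v := j)) E \<phi>" for j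
    using fresh by (intro sat_cong) auto
  have \<chi>: "sat M L (e(N := n, v := j)) E ?\<chi> \<longleftrightarrow> j = n \<or> sat M L (e(v := j)) E \<phi>" for j
    using v drop by auto
  have "\<exists>k\<in>L. sat M L (e(N := n, v := k)) E ?\<chi> \<and>
          (\<forall>j\<in>L. lss M j k \<longrightarrow> \<not> sat M L (e(N := n, v := j)) E ?\<chi>)"
    by (rule delta0_least[where x = n]) (use assms \<chi> in auto)
  then obtain k where k: "k \<in> L" "k = n \<or> sat M L (e(v := k)) E \<phi>"
      "\<And>j. j \<in> L \<Longrightarrow> lss M j k \<Longrightarrow> j \<noteq> n \<and> \<not> sat M L (e(v := j)) E \<phi>"
    unfolding \<chi> by blast
  then have "lss M k (add M n (one M))"
    using lss_linear[of k n] assms by (auto simp: lss_add_one_iff)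
  then show ?thesis using k by (auto simp: least_index_def)
qed

text \<open>Either a witness is found before \<open>n\<close> and both indices coincide, or
  \<open>k = n\<close> and \<open>k' \<ge> n\<close>. In the second case both values lie in the
  half-open interval from 0 to \<open>2^-n\<close>, with 0 excluded, so they differ by less than
  \<open>2^-n\<close>.\<close>

lemma least_index_Cauchy:
  assumes "n \<in> L" "i \<in> L" "E0 \<in> S"
    and k: "least_index M L F n k" and k': "least_index M L F (add M n i) k'"
  shows "rat_less M (rat_diff M (one M, zer M, exp2 M k) (one M, zer M, exp2 M k')) (rat_exp2_neg M n)"
    and "rat_less M (rat_diff M (one M, zer M, exp2 M k') (one M, zer M, exp2 M k)) (rat_exp2_neg M n)"
proof -
  let ?c = "exp2 M k" and ?c' = "exp2 M k'" and ?p = "exp2 M n"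
  have L: "k \<in> L" "k' \<in> L" using k k' by (auto simp: least_index_def)
  have pos: "lss M (zer M) ?c" "lss M (zer M) ?c'" "lss M (zer M) ?p"
    using exp2_pos assms(3) L assms(1) by auto
  have cc: "lss M (zer M) (mul M ?c ?c')" "lss M (zer M) (mul M ?c' ?p)" "lss M (zer M) (mul M ?c ?p)"
    using pos L assms by (auto intro!: mul_pos)
  have or: "k = k' \<or> k = n \<and> \<not> lss M ?c' ?c"
  proof (cases "k = n")
    case True
    have "\<not> lss M k' n"
    proof
      assume less: "lss M k' n"
      \<comment> \<open>As \<open>k = n\<close>, there is no witness below \<open>n\<close>, so
        \<open>k'\<close> is not one.\<close>
      then have "k' = add M n i" using k k' True L by (auto simp: least_index_def)
      then show False using less add_not_lss assms by blast
    qed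
    then have "k' = n \<or> (\<exists>z\<in>L. k' = add M n z)"
      using lss_linear[of k' n] lss_imp_add[of n k'] L assms by blast
    then show ?thesis using True exp2_mono[of n _ E0] assms by auto
  next
    case False
    then have F: "F k" using k by (auto simp: least_index_def)
    have kn: "lss M k n" using k False L assms by (auto simp: least_index_def lss_add_one_iff)
    \<comment> \<open>A witness below \<open>n\<close> remains the least index at
      \<open>n + i\<close>, so uniqueness applies.\<close>
    have "lss M k (add M n i)"
      using kn add_pos[of n i] zer_or_pos[of i] lss_trans[of k n "add M n i"] L assms by auto
    then have "least_index M L F (add M n i) k"
      using k F assms L by (auto simp: least_index_def lss_add_one_iff)
    then show ?thesis using least_index_unique[OF _ _ k'] assms by auto
  qed
  \<comment> \<open>This is \<open>1/c - 1/c' < 1/p\<close> with denominators cleared; the next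
    inequality exchanges \<open>c\<close> and \<open>c'\<close>.\<close>
  have "lss M (mul M ?c' ?p) (add M (mul M ?c ?c') (mul M ?c ?p))"
    using or
  proof
    assume "k = k'"
    then show ?thesis using cc L assms add_pos[of "mul M ?c' ?p" "mul M ?c ?c'"]
      by (simp add: add_comm)
  next
    assume "k = n \<and> \<not> lss M ?c' ?c"
    then show ?thesis using cc L assms add_pos[of "mul M ?c' ?p" "mul M ?c ?p"]
      by (simp add: mul_comm)
  qed
  moreover have "lss M (mul M ?c ?p) (add M (mul M ?c' ?c) (mul M ?c' ?p))"
    using or
  proof
    assume "k = k'"
    then show ?thesis using cc L assms add_pos[of "mul M ?c' ?p" "mul M ?c ?c'"]
      by (simp add: add_comm)
  next
    \<comment> \<open>Only this direction uses \<open>c \<le> c'\<close>: then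
      \<open>c p \<le> c' p\<close>, and the extra summand \<open>c' c\<close> is positive.\<close>
    assume *: "k = n \<and> \<not> lss M ?c' ?c"
    then have "?c = ?c' \<or> lss M ?c ?c'" using lss_linear[of ?c ?c'] L by auto
    then have "mul M ?c ?p = mul M ?c' ?p \<or> lss M (mul M ?c ?p) (mul M ?c' ?p)"
      using mul_mono1[of ?c ?c' ?p] pos L assms by auto
    moreover have "lss M (mul M ?c' ?p) (add M (mul M ?c' ?c) (mul M ?c' ?p))"
      using cc L assms add_pos[of "mul M ?c' ?p" "mul M ?c' ?c"]
      by (simp add: add_comm mul_comm)
    ultimately show ?thesis
      using lss_trans[of "mul M ?c ?p" "mul M ?c' ?p" "add M (mul M ?c' ?c) (mul M ?c' ?p)"] L assms
      by auto
  qed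
  ultimately show
    "rat_less M (rat_diff M (one M, zer M, ?c) (one M, zer M, ?c')) (rat_exp2_neg M n)"
    "rat_less M (rat_diff M (one M, zer M, ?c') (one M, zer M, ?c)) (rat_exp2_neg M n)"
    using L assms by (simp_all add: rat_exp2_neg_def)
qed

section \<open>Positivity of the real in a model\<close>

definition bound_var :: nat where
  "bound_var = (LEAST u. u \<notin> fvn (graph (least_seq v \<phi> N)) \<union> {N, N + 1, N + 2, N + 3})"

text \<open>The matrix of \<open>positive\<close> for this real, kept separate from the quantifier
  over \<open>\<nat>\<close> so that it can be evaluated in the nonstandard level too.\<close>

definition pos_body :: delta0 where
  "pos_body = BEx N (Var bound_var) (BEx (N + 1) (Var bound_var) (BEx (N + 2) (Var bound_var)
     (BEx (N + 3) (Var bound_var) (Conj (graph (least_seq v \<phi> N))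
       (Less (Add (Mul One (Var (N + 3))) (Mul (Var (N + 2)) (Exp2 (Var N))))
             (Mul (Var (N + 1)) (Exp2 (Var N))))))))"

lemma positive_least_seq: "positive (least_seq v \<phi> N) = ExN bound_var pos_body"
  by (simp add: positive_def pos_body_def bound_var_def Let_def)

text \<open>Since \<open>v\<close> is bound in the graph, \<open>bound_var\<close> may be
  \<open>v\<close> itself; hence only \<open>fvn \<phi> - {v}\<close> is excluded.\<close>

lemma bound_var_fresh: "bound_var \<notin> (fvn \<phi> - {v}) \<union> {N, N + 1, N + 2, N + 3}"
proof -
  have "\<exists>u. u \<notin> fvn (graph (least_seq v \<phi> N)) \<union> {N, N + 1, N + 2, N + 3}"
    using finite_fvn by (intro ex_new_if_finite infinite_UNIV_nat) auto
  from LeastI_ex[OF this, folded bound_var_def] show ?thesis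
    unfolding fvn_least_seq by blast
qed

text \<open>In \<open>oplus\<close> the free variables are the parameters that vary. Having the same
  ones allows the formula decided for the real to be reused for \<open>\<phi>\<close>.\<close>

lemma hfvn_positive: "hfvn (positive (least_seq v \<phi> N)) = fvn \<phi> - {v}"
  using fresh bound_var_fresh fvn_least_seq by (auto simp: positive_least_seq pos_body_def)

lemma hfvs_positive: "hfvs (positive (least_seq v \<phi> N)) = fvs \<phi>"
proof -
  have "fvs (graph (least_seq v \<phi> N)) = fvs \<phi>" by (simp add: least_seq_def)
  then show ?thesis by (simp add: positive_least_seq pos_body_def)
qed

text \<open>With \<open>a = 1\<close>, \<open>b = 0\<close> and \<open>c = 2^k\<close>, the
  inequality \<open>c + b 2^n < a 2^n\<close> becomes \<open>2^k < 2^n\<close>. The conditions that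
  1 and 0 lie below \<open>u\<close> come from the bounds on \<open>a\<close> and
  \<open>b\<close>.\<close>

lemma sat_pos_body:
  assumes e: "range e \<subseteq> L" and u: "u \<in> L"
  shows "sat M L (e(bound_var := u)) E pos_body \<longleftrightarrow>
    (\<exists>n\<in>L. lss M n u \<and> lss M (one M) u \<and> lss M (zer M) u \<and>
      (\<exists>k. least_index M L (\<lambda>j. sat M L (e(v := j)) E \<phi>) n k \<and> lss M (exp2 M k) u \<and>
           lss M (exp2 M k) (exp2 M n)))" (is "_ \<longleftrightarrow> ?rhs")
proof -
  let ?e = "\<lambda>n a b c. e(bound_var := u, N := n, Suc N := a, Suc (Suc N) := b, N + 3 := c)"
  have graph: "sat M L (?e n a b c) E (graph (least_seq v \<phi> N)) \<longleftrightarrow>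
      a = one M \<and> b = zer M \<and>
      (\<exists>k. least_index M L (\<lambda>j. sat M L (e(v := j)) E \<phi>) n k \<and> c = exp2 M k)"
    if "n \<in> L" "a \<in> L" "b \<in> L" "c \<in> L" for n a b c
  proof -
    \<comment> \<open>If \<open>bound_var\<close> is \<open>v\<close>, the update at
      \<open>v\<close> overwrites \<open>u\<close>.\<close>
    have \<phi>: "sat M L ((e(bound_var := u))(v := j)) E \<phi> \<longleftrightarrow> sat M L (e(v := j)) E \<phi>" for j
      using bound_var_fresh by (intro sat_cong) auto
    show ?thesis
      using that e u by (subst sat_graph[where e\<^sub>0 = "e(bound_var := u)"]) (auto simp: \<phi>)
  qed
  have L: "k \<in> L" if "least_index M L F n k" for F n k using that by (simp add: least_index_def)
  have "sat M L (e(bound_var := u)) E pos_body \<longleftrightarrow>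
      (\<exists>n\<in>L. lss M n u \<and> (\<exists>a\<in>L. lss M a u \<and> (\<exists>b\<in>L. lss M b u \<and> (\<exists>c\<in>L. lss M c u \<and>
        sat M L (?e n a b c) E (graph (least_seq v \<phi> N)) \<and>
        lss M (add M c (mul M b (exp2 M n))) (mul M a (exp2 M n))))))"
    using bound_var_fresh unfolding pos_body_def by (simp cong: bex_cong)
  also have "\<dots> \<longleftrightarrow>
      (\<exists>n\<in>L. lss M n u \<and> lss M (one M) u \<and> lss M (zer M) u \<and> (\<exists>c\<in>L. lss M c u \<and>
        (\<exists>k. least_index M L (\<lambda>j. sat M L (e(v := j)) E \<phi>) n k \<and> c = exp2 M k) \<and>
        lss M c (exp2 M n)))"
    by (simp add: graph cong: bex_cong conj_cong) (rule bex_cong; force)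
  also have "\<dots> \<longleftrightarrow> ?rhs"
    using L by (intro bex_cong) auto
  finally show ?thesis .
qed

text \<open>\<open>2^k < 2^n\<close> rules out \<open>k = n\<close>, so the least index
  \<open>k\<close> satisfies \<open>\<phi>\<close>.\<close>

lemma pos_body_imp:
  assumes "range e \<subseteq> L" "u \<in> L" "sat M L (e(bound_var := u)) E pos_body"
  shows "\<exists>k\<in>L. sat M L (e(v := k)) E \<phi>"
  using assms sat_pos_body[of e u E] by (auto simp: least_index_def)

lemma imp_pos_body:
  assumes e: "range e \<subseteq> L" "range E \<subseteq> S" and "j \<in> L" "sat M L (e(v := j)) E \<phi>"
  shows "\<exists>u\<in>L. sat M L (e(bound_var := u)) E pos_body"
proof -
  obtain k where k: "k \<in> L" "sat M L (e(v := k)) E \<phi>"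
      "\<forall>j\<in>L. lss M j k \<longrightarrow> \<not> sat M L (e(v := j)) E \<phi>"
    using delta0_least[OF assms] by blast
  \<comment> \<open>For the least witness \<open>k\<close>, the first index with
    \<open>q_n > 2^-n\<close> is \<open>k + 1\<close>: up to \<open>k\<close> the value is exactly
    \<open>2^-n\<close>.\<close>
  define n where "n = add M k (one M)"
  have n: "n \<in> L" "lss M k n" using k add_pos[of k "one M"] by (auto simp: n_def)
  have least: "least_index M L (\<lambda>j. sat M L (e(v := j)) E \<phi>) n k"
    using k n by (auto simp: least_index_def lss_add_one_iff)
  \<comment> \<open>A single \<open>u\<close> has to exceed \<open>n\<close>, \<open>2^k\<close>, 1
    and 0.\<close>
  obtain u1 where u1: "u1 \<in> L" "lss M n u1" "lss M (exp2 M k) u1"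
    using upper_bound[of n "exp2 M k"] k n by auto
  obtain u where u: "u \<in> L" "lss M u1 u" "lss M (one M) u"
    using upper_bound[of u1 "one M"] u1 by auto
  have "lss M n u" "lss M (exp2 M k) u" "lss M (zer M) u"
    using lss_trans[of n u1 u] lss_trans[of "exp2 M k" u1 u] lss_trans[of "zer M" "one M" u] u u1 k n
    by auto
  moreover have "lss M (exp2 M k) (exp2 M n)"
    using exp2_lss_exp2_add_one[of k "E 0"] k subsetD[OF e(2) rangeI] by (simp add: n_def)
  ultimately show ?thesis using sat_pos_body[OF e(1) u(1)] least n u by blast
qed

end

lemma is_real_least_seq:
  assumes "fresh_isigma1 M (stdN M) (stdP M) v \<phi> N" "(e, E) \<in> std_asg M"
  shows "is_real M e E (least_seq v \<phi> N)"
proof -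
  interpret fresh_isigma1 M "stdN M" "stdP M" v \<phi> N by fact
  have e: "range e \<subseteq> stdN M" "range E \<subseteq> stdP M" using assms(2) by (auto simp: asg_def)
  let ?I = "least_index M (stdN M) (\<lambda>j. sat M (stdN M) (e(v := j)) E \<phi>)"
  have val: "seq_val M e E (least_seq v \<phi> N) n q \<longleftrightarrow> (\<exists>k. ?I n k \<and> q = (one M, zer M, exp2 M k))"
    if n: "n \<in> stdN M" for n q
  proof (cases q)
    case (fields a b c)
    have "sat M (stdN M) (e(N := n, N + 1 := a, N + 2 := b, N + 3 := c)) E (graph (least_seq v \<phi> N)) \<longleftrightarrow>
        a = one M \<and> b = zer M \<and> (\<exists>k. ?I n k \<and> c = exp2 M k)"
      if "a \<in> stdN M" "b \<in> stdN M" "c \<in> stdN M"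
      using that n e by (subst sat_graph[where e\<^sub>0 = e]) auto
    moreover have "exp2 M k \<in> stdN M" if "?I n k" for k using that by (simp add: least_index_def)
    ultimately show ?thesis using fields by (auto simp: sat_std_def)
  qed
  have "\<exists>!q. seq_val M e E (least_seq v \<phi> N) n q" if "n \<in> stdN M" for n
    using least_index_exists[OF e that] least_index_unique[OF that] val[OF that] by metis
  moreover have "c \<noteq> zer M" if q: "n \<in> stdN M" "seq_val M e E (least_seq v \<phi> N) n (a, b, c)" for n a b c
  proof -
    obtain k where "?I n k" "c = exp2 M k" using iffD1[OF val q(2)] q(1) by blast
    then have "lss M (zer M) c"
      using exp2_pos[OF _ subsetD[OF e(2) rangeI]] by (simp add: least_index_def)
    then show ?thesis using lss_irrefl[OF closed(1)] by metis
  qed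
  ultimately have "rational_sequence M e E (least_seq v \<phi> N)"
    unfolding rational_sequence_def by blast
  moreover have "rat_less M (rat_diff M q q') (rat_exp2_neg M n) \<and>
      rat_less M (rat_diff M q' q) (rat_exp2_neg M n)"
    if n: "n \<in> stdN M" "i \<in> stdN M"
      and q: "seq_val M e E (least_seq v \<phi> N) n q" "seq_val M e E (least_seq v \<phi> N) (add M n i) q'"
    for n i q q'
  proof -
    obtain k k' where "?I n k" "q = (one M, zer M, exp2 M k)"
        "?I (add M n i) k'" "q' = (one M, zer M, exp2 M k')"
      using iffD1[OF val q(1)] iffD1[OF val q(2)] n closed(3) by blast
    then show ?thesis
      using least_index_Cauchy[OF n subsetD[OF e(2) rangeI]] by simp
  qed
  ultimately show ?thesis unfolding is_real_def by blast
qed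

section \<open>Hyperdisjunction and hypernegation\<close>

text \<open>Invariance and both implications are universal over the parameter domain, so the same
  formula works on a smaller one. This restricts \<open>LPO\<close> to the parameters for which
  \<open>x\<close> is a real.\<close>

lemma oplus_antimono:
  assumes "oplus M D A B" "D' \<subseteq> D"
  shows "oplus M D' A B"
  using assms unfolding oplus_def Omega_invariant_def Let_def by (fast dest: subsetD)

text \<open>One-way implications suffice, as the deciding formula, \<open>\<omega>\<close> and the
  fixed parameters are kept.\<close>

lemma oplus_cong:
  assumes "oplus M D A B"
    and "hfvn A \<union> hfvn B = hfvn A' \<union> hfvn B'" "hfvs A \<union> hfvs B = hfvs A' \<union> hfvs B'"
    and "\<And>e E. (e, E) \<in> D \<Longrightarrow> holds M e E A \<and> in_T M e E A \<Longrightarrow> holds M e E A' \<and> in_T M e E A'"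
    and "\<And>e E. (e, E) \<in> D \<Longrightarrow> holds M e E B \<and> in_T M e E B \<Longrightarrow> holds M e E B' \<and> in_T M e E B'"
  shows "oplus M D A' B'"
proof -
  obtain \<psi> m \<omega> e\<^sub>0 E\<^sub>0 where *: "(e\<^sub>0, E\<^sub>0) \<in> std_asg M" "m \<notin> hfvn A' \<union> hfvn B'"
    "let \<Psi> = (\<lambda>e E x. sat_star M ((override_on e\<^sub>0 e (hfvn A' \<union> hfvn B'))(m := x))
         (override_on E\<^sub>0 E (hfvs A' \<union> hfvs B')) \<psi>) in
         Omega_invariant M D \<Psi> \<omega> \<and>
         (\<forall>(e, E) \<in> D.
            (\<Psi> e E \<omega> \<longrightarrow> holds M e E A \<and> in_T M e E A) \<and>
            (\<not> \<Psi> e E \<omega> \<longrightarrow> holds M e E B \<and> in_T M e E B))"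
    using assms(1) unfolding oplus_def assms(2,3) Let_def by blast
  show ?thesis
    unfolding oplus_def Let_def
    using * assms(4,5) unfolding Let_def
    by (intro exI[of _ \<psi>] exI[of _ m] exI[of _ \<omega>] bexI[of _ "(e\<^sub>0, E\<^sub>0)"]) auto
qed

text \<open>Membership in \<open>\<T>\<close> is trivial for the existential formula. For its
  hypernegation it is the transfer of the universal prenex form, which supplies the second
  conjunct.\<close>

lemma holds_HNot_ExN:
  assumes "zer M \<noteq> one M"
  shows "holds M e E (HNot (ExN v \<phi>)) \<and> in_T M e E (HNot (ExN v \<phi>)) \<longleftrightarrow>
    (\<forall>n\<in>stdN M. \<not> sat_std M (e(v := n)) E \<phi>) \<and> (\<forall>n. \<not> sat_star M (e(v := n)) E \<phi>)"
  using assms by (auto simp: HNot_def in_T_def sat_std_def sat_star_def)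

section \<open>The two implications\<close>

lemma LPO_imp_LPR: "LPO M \<Longrightarrow> LPR M"
  unfolding LPR_def LPO_def positive_def Let_def by (blast intro: oplus_antimono)

lemma LPR_imp_LPO:
  fixes M :: "'a nsa_struct"
  assumes ax: "NSA_axioms M" and "LPR M"
  shows "LPO M"
  unfolding LPO_def
proof (intro allI)
  fix v \<phi>
  have "finite (fvn \<phi> \<union> {v})" using finite_fvn by simp
  then obtain N where N: "\<forall>i \<in> fvn \<phi> \<union> {v}. i < N"
    using finite_nat_set_iff_bounded by blast
  interpret std: fresh_isigma1 M "stdN M" "stdP M" v \<phi> N
    using ax N by unfold_locales (auto simp: NSA_axioms_def)
  interpret ext: fresh_isigma1 M UNIV "extP M" v \<phi> N
    using ax N by unfold_locales (auto simp: NSA_axioms_def)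
  let ?x = "least_seq v \<phi> N"
  \<comment> \<open>Induction in the nonstandard level requires the star images to be among its
    sets.\<close>
  have star: "range (star M \<circ> E) \<subseteq> extP M" if "range E \<subseteq> stdP M"
    for E :: "nat \<Rightarrow> 'a set"
    using ax that unfolding NSA_axioms_def embedding_def star_def by fastforce
  \<comment> \<open>Every choice of standard parameters gives a real, so the restriction in
    \<open>LPR\<close> disappears.\<close>
  have all_real: "{(e, E) \<in> std_asg M. is_real M e E ?x} = std_asg M"
    using is_real_least_seq[OF std.fresh_isigma1_axioms] by auto
  have "oplus M (std_asg M) (positive ?x) (HNot (positive ?x))"
    using mp[OF spec[OF \<open>LPR M\<close>[unfolded LPR_def]] wf_least_seq[of v \<phi> N]]
    unfolding all_real .
  then show "oplus M (std_asg M) (ExN v \<phi>) (HNot (ExN v \<phi>))"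
  proof (rule oplus_cong)
    fix e E
    assume "(e, E) \<in> std_asg M"
    then have e: "range e \<subseteq> stdN M" "range E \<subseteq> stdP M" by (auto simp: asg_def)
    show "holds M e E (ExN v \<phi>) \<and> in_T M e E (ExN v \<phi>)"
      if "holds M e E (positive ?x) \<and> in_T M e E (positive ?x)"
      using that std.pos_body_imp[OF e(1)]
      by (auto simp: std.positive_least_seq in_T_def sat_std_def)
    \<comment> \<open>A witness of \<open>\<phi>\<close> in either level would give one of
      positivity in the same level, where the hypernegation excludes it.\<close>
    show "holds M e E (HNot (ExN v \<phi>)) \<and> in_T M e E (HNot (ExN v \<phi>))"
      if "holds M e E (HNot (positive ?x)) \<and> in_T M e E (HNot (positive ?x))"
      using that std.imp_pos_body[OF e] ext.imp_pos_body[OF _ star[OF e(2)], of e]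
      unfolding std.positive_least_seq holds_HNot_ExN[OF std.zer_neq_one]
      by (auto simp: sat_std_def sat_star_def)
  qed (simp_all add: HNot_def std.hfvn_positive std.hfvs_positive)
qed

theorem mainTheorem3:
  fixes M :: "'n nsa_struct"
  assumes "NSA M"
  shows "LPO M \<longleftrightarrow> LPR M"
  using assms LPO_imp_LPR LPR_imp_LPO by (auto simp: NSA_def)

end
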